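(* If $r\ge 3$ is an integer, then $\mathrm{gcover}_e(BF(r)) = \mathrm{gpart}_e(BF(r)) = 2^r$.
   Context: A geodesic of a graph $G$ is a shortest path in $G$ between its two end vertices. An edge geodesic cover of $G$ is a set of geodesics that cover the edge set of $G$ (each edge lies on at least one of them); $\mathrm{gcover}_e(G)$ is the minimum cardinality of an edge geodesic cover. An edge geodesic partition of $G$ is a set of pairwise edge-disjoint geodesics that cover the edge set of $G$ (each edge lies on exactly one of them); $\mathrm{gpart}_e(G)$ is the minimum cardinality of an edge geodesic partition. The $r$-dimensional butterfly network $BF(r)$ is the (undirected) graph with vertices $[j,s]$, where $j\in\{0,1,\ldots,r\}$ and $s=(s_0,\ldots,s_{r-1})\in\{0,1\}^r$; vertices $[j,s]$ and $[j',s']$ are adjacent if $j'=j+1$ and either $s=s'$ or $s$ and $s'$ differ precisely in the $j$-th bit (the coordinate indexed by $j$, for $0\le j\le r-1$). The vertex $[j,s]$ is said to be at level $j$. *)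

theory Defs
  imports Main
begin

text \<open>A simple undirected graph is a pair of a vertex set and a set of edges, each edge being
  a two-element set of vertices. A path is given by the list of its vertices; one-vertex paths are
  allowed.\<close>

type_synonym 'a ugraph = "'a set \<times> 'a set set"

abbreviation verts :: "'a ugraph \<Rightarrow> 'a set" where "verts G \<equiv> fst G"
abbreviation edges :: "'a ugraph \<Rightarrow> 'a set set" where "edges G \<equiv> snd G"

definition path_edges :: "'a list \<Rightarrow> 'a set set" where
  "path_edges p = {{p ! i, p ! Suc i} | i. Suc i < length p}"

definition is_path :: "'a ugraph \<Rightarrow> 'a list \<Rightarrow> bool" where
  "is_path G p \<longleftrightarrow>
     p \<noteq> [] \<and> distinct p \<and> set p \<subseteq> verts G \<and> path_edges p \<subseteq> edges G"

definition geodesic :: "'a ugraph \<Rightarrow> 'a list \<Rightarrow> bool" where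
  "geodesic G p \<longleftrightarrow> is_path G p \<and>
     (\<forall>q. is_path G q \<and> hd q = hd p \<and> last q = last p \<longrightarrow> length p \<le> length q)"

text \<open>A path and its reversal are different lists. This does not affect the minimum
  cardinalities below: in a cover one of the two can be dropped, and a partition cannot contain
  both unless they have no edges. Finiteness is required explicitly because \<open>card\<close> of an infinite
  set is \<open>0\<close>.\<close>

definition edge_geodesic_cover :: "'a ugraph \<Rightarrow> 'a list set \<Rightarrow> bool" where
  "edge_geodesic_cover G P \<longleftrightarrow>
     finite P \<and> (\<forall>p\<in>P. geodesic G p) \<and> (\<forall>e\<in>edges G. \<exists>p\<in>P. e \<in> path_edges p)"

definition edge_geodesic_partition :: "'a ugraph \<Rightarrow> 'a list set \<Rightarrow> bool" where
  "edge_geodesic_partition G P \<longleftrightarrow>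
     edge_geodesic_cover G P \<and>
     (\<forall>p\<in>P. \<forall>q\<in>P. p \<noteq> q \<longrightarrow> path_edges p \<inter> path_edges q = {})"

definition gcover_e :: "'a ugraph \<Rightarrow> nat" where
  "gcover_e G = (LEAST k. \<exists>P. edge_geodesic_cover G P \<and> card P = k)"

definition gpart_e :: "'a ugraph \<Rightarrow> nat" where
  "gpart_e G = (LEAST k. \<exists>P. edge_geodesic_partition G P \<and> card P = k)"

text \<open>The vertex \<open>[j, s]\<close> of the butterfly network is the pair \<open>(j, s)\<close>, with the bit string
  \<open>s = (s\<^sub>0, \<dots>, s\<^sub>r\<^sub>-\<^sub>1)\<close> given as a list of \<open>r\<close> Booleans.\<close>

definition butterfly_verts :: "nat \<Rightarrow> (nat \<times> bool list) set" where
  "butterfly_verts r = {(j, s). j \<le> r \<and> length s = r}"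

definition butterfly :: "nat \<Rightarrow> (nat \<times> bool list) ugraph" where
  "butterfly r =
     (butterfly_verts r,
      {{(j, s), (j', s')} | j s j' s'.
         (j, s) \<in> butterfly_verts r \<and> (j', s') \<in> butterfly_verts r \<and>
         j' = j + 1 \<and> (s = s' \<or> {i. i < r \<and> s ! i \<noteq> s' ! i} = {j})})"

end

theory Submission
  imports Defs
begin

text \<open>Two vertices of the butterfly network at levels \<open>j \<le> k\<close> are joined by a walk that goes from
  \<open>j\<close> to level \<open>0\<close>, on to level \<open>r\<close> and back to \<open>k\<close>. Every bit can be set on the way, and there are
  \<open>j + r + (r - k) \<le> 2 * r\<close> steps. Hence no geodesic has more than \<open>2 * r\<close> edges
  (\<open>butterfly_geodesic_length_le\<close>). A partition of the edges into geodesics with exactly \<open>2 * r\<close>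
  edges each is therefore a smallest cover and a smallest partition at once
  (\<open>cover_partition_number_eqI\<close>), and it remains to find one with \<open>2 ^ r\<close> members.

  A path from level \<open>0\<close> to level \<open>r\<close> and back is a geodesic as soon as its ends differ in the last
  bit, since only an edge at level \<open>r\<close> changes that bit (\<open>butterfly_path_length_ge\<close>). There is one
  such path for each of the \<open>2 ^ r\<close> strings \<open>t\<close>: it reaches \<open>(r, t)\<close> by straight edges only and
  returns by crossing edges only. Here a straight edge joins equal strings and a crossing edge
  strings that differ in one bit. Given an edge, following straight edges from a straight one, or
  crossing edges from a crossing one, up to level \<open>r\<close> recovers \<open>t\<close>; so every edge lies on exactly
  one of these paths (\<open>turning_paths_partition\<close>).\<close>

section \<open>Paths, walks and a counting bound\<close>

lemma path_edges_map_upt: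
  "path_edges (map f [0..<Suc n]) = {{f i, f (Suc i)} | i. i < n}"
  unfolding path_edges_def by (force simp del: upt_Suc)

lemma path_edges_conv_image:
  "path_edges p = (\<lambda>i. {p ! i, p ! Suc i}) ` {..<length p - 1}"
  unfolding path_edges_def by auto

lemma finite_path_edges [simp]: "finite (path_edges p)"
  by (simp add: path_edges_conv_image)

lemma card_path_edges_le: "card (path_edges p) \<le> length p - 1"
  unfolding path_edges_conv_image using card_image_le[of "{..<length p - 1}"] by simp

lemma card_path_edges_distinct:
  assumes "distinct p"
  shows "card (path_edges p) = length p - 1"
proof -
  have "inj_on (\<lambda>i. {p ! i, p ! Suc i}) {..<length p - 1}"
  proof (rule inj_onI)
    fix i k
    assume "i \<in> {..<length p - 1}" "k \<in> {..<length p - 1}"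
      and "{p ! i, p ! Suc i} = {p ! k, p ! Suc k}"
    then show "i = k"
      using assms by (auto simp: doubleton_eq_iff nth_eq_iff_index_eq)
  qed
  then show ?thesis by (simp add: path_edges_conv_image card_image)
qed

lemma path_edges_snoc:
  assumes "q \<noteq> []"
  shows "path_edges (q @ [v]) = insert {last q, v} (path_edges q)"
proof -
  obtain m where m: "length q = Suc m" using assms by (cases q) auto
  have "path_edges (q @ [v]) = (\<lambda>i. {(q @ [v]) ! i, (q @ [v]) ! Suc i}) ` {..<Suc m}"
    by (simp add: path_edges_conv_image m)
  also have "\<dots> = insert {last q, v} ((\<lambda>i. {q ! i, q ! Suc i}) ` {..<m})"
    using m assms by (auto simp: lessThan_Suc nth_append last_conv_nth)
  finally show ?thesis by (simp add: path_edges_conv_image m)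
qed

lemma path_edges_prefix: "path_edges xs \<subseteq> path_edges (xs @ ys)"
proof
  fix e assume "e \<in> path_edges xs"
  then obtain i where i: "Suc i < length xs" "e = {xs ! i, xs ! Suc i}"
    unfolding path_edges_def by blast
  then have "Suc i < length (xs @ ys)" "e = {(xs @ ys) ! i, (xs @ ys) ! Suc i}"
    by (auto simp: nth_append)
  then show "e \<in> path_edges (xs @ ys)" unfolding path_edges_def by blast
qed

definition adj :: "'a ugraph \<Rightarrow> ('a \<times> 'a) set" where
  "adj G = {(u, v). {u, v} \<in> edges G}"

lemma adj_relpow_sym:
  assumes "(u, v) \<in> adj G ^^ n"
  shows "(v, u) \<in> adj G ^^ n"
  using assms
proof (induction n arbitrary: v)
  case (Suc n)
  then obtain w where w: "(u, w) \<in> adj G ^^ n" "(w, v) \<in> adj G" by auto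
  then have "(v, w) \<in> adj G" by (simp add: adj_def insert_commute)
  with Suc.IH[OF w(1)] show ?case by (rule relpow_Suc_I2[rotated])
qed simp

text \<open>Cutting out the detour between two visits to the same vertex turns a walk into a path.\<close>

lemma walk_contains_path:
  assumes "\<And>e. e \<in> edges G \<Longrightarrow> e \<subseteq> verts G" and "u \<in> verts G"
    and "(u, v) \<in> adj G ^^ n"
  shows "\<exists>q. is_path G q \<and> hd q = u \<and> last q = v \<and> length q \<le> Suc n"
  using assms(3)
proof (induction n arbitrary: v)
  case 0
  then have "is_path G [u] \<and> hd [u] = u \<and> last [u] = v \<and> length [u] \<le> Suc 0"
    using assms(2) by (auto simp: is_path_def path_edges_def)
  then show ?case by blast
next
  case (Suc n)
  then obtain w where w: "(u, w) \<in> adj G ^^ n" "{w, v} \<in> edges G" by (auto simp: adj_def)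
  obtain q where q: "is_path G q" "hd q = u" "last q = w" "length q \<le> Suc n"
    using Suc.IH[OF w(1)] by blast
  then have ne: "q \<noteq> []" by (simp add: is_path_def)
  show ?case
  proof (cases "v \<in> set q")
    case True
    then obtain xs ys where split: "q = (xs @ [v]) @ ys" by (auto simp: in_set_conv_decomp)
    have "is_path G (xs @ [v])"
      using q(1) path_edges_prefix[of "xs @ [v]" ys] unfolding split is_path_def by auto
    moreover have "hd (xs @ [v]) = u" using q(2) unfolding split by (cases xs) auto
    moreover have "length (xs @ [v]) \<le> Suc (Suc n)" using q(4) unfolding split by simp
    ultimately show ?thesis by (intro exI[of _ "xs @ [v]"]) simp
  next
    case False
    have "is_path G (q @ [v])"
      using q w(2) ne False assms(1)[OF w(2)] by (auto simp: is_path_def path_edges_snoc)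
    then show ?thesis using q ne by (intro exI[of _ "q @ [v]"]) simp
  qed
qed

lemma geodesic_length_le_walk:
  assumes "\<And>e. e \<in> edges G \<Longrightarrow> e \<subseteq> verts G" and "geodesic G p"
    and "(hd p, last p) \<in> adj G ^^ n"
  shows "length p - 1 \<le> n"
proof -
  have "hd p \<in> verts G" using assms(2) by (auto simp: geodesic_def is_path_def)
  from walk_contains_path[OF assms(1) this assms(3)] obtain q
    where "is_path G q" "hd q = hd p" "last q = last p" "length q \<le> Suc n" by blast
  with assms(2) have "length p \<le> Suc n" unfolding geodesic_def by force
  then show ?thesis by simp
qed

text \<open>Counting edges: a cover by geodesics with at most \<open>d\<close> edges has at least
  \<open>card (edges G) / d\<close> members. A partition into geodesics with exactly \<open>d\<close> edges attains this
  bound, and being also a cover it determines both numbers.\<close>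

lemma cover_partition_number_eqI:
  assumes part: "edge_geodesic_partition G P"
    and exact: "\<And>p. p \<in> P \<Longrightarrow> length p = Suc d"
    and bound: "\<And>p. geodesic G p \<Longrightarrow> length p - 1 \<le> d"
    and "d > 0"
  shows "gcover_e G = card P \<and> gpart_e G = card P"
proof -
  have cover: "edge_geodesic_cover G P"
    and disj: "\<And>p q. p \<in> P \<Longrightarrow> q \<in> P \<Longrightarrow> p \<noteq> q \<Longrightarrow> path_edges p \<inter> path_edges q = {}"
    using part by (auto simp: edge_geodesic_partition_def)
  have finP: "finite P" and geo: "\<And>p. p \<in> P \<Longrightarrow> geodesic G p"
    using cover by (auto simp: edge_geodesic_cover_def)
  have E: "edges G = (\<Union>p\<in>P. path_edges p)"
    using cover by (auto simp: edge_geodesic_cover_def geodesic_def is_path_def)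
  have "card (edges G) = (\<Sum>p\<in>P. card (path_edges p))"
    unfolding E using finP disj by (intro card_UN_disjoint) auto
  also have "\<dots> = (\<Sum>p\<in>P. d)"
    using geo exact
    by (intro sum.cong) (auto simp: card_path_edges_distinct geodesic_def is_path_def)
  finally have cardE: "card (edges G) = card P * d" by simp
  have lower: "card P \<le> card Q" if Q: "edge_geodesic_cover G Q" for Q
  proof -
    have finQ: "finite Q" using Q by (simp add: edge_geodesic_cover_def)
    have "edges G \<subseteq> (\<Union>p\<in>Q. path_edges p)"
      using Q by (auto simp: edge_geodesic_cover_def)
    then have "card (edges G) \<le> card (\<Union>p\<in>Q. path_edges p)"
      using finQ by (intro card_mono) auto
    also have "\<dots> \<le> (\<Sum>p\<in>Q. card (path_edges p))"
      using finQ by (rule card_UN_le)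
    also have "\<dots> \<le> (\<Sum>p\<in>Q. d)"
    proof (rule sum_mono)
      fix p assume "p \<in> Q"
      then have "geodesic G p" using Q by (simp add: edge_geodesic_cover_def)
      then show "card (path_edges p) \<le> d"
        using card_path_edges_le[of p] bound by (meson le_trans)
    qed
    finally show ?thesis using cardE \<open>d > 0\<close> by simp
  qed
  have "gcover_e G = card P"
    unfolding gcover_e_def using cover lower by (intro Least_equality) auto
  moreover have "gpart_e G = card P"
    unfolding gpart_e_def using part lower
    by (intro Least_equality) (auto simp: edge_geodesic_partition_def)
  ultimately show ?thesis by simp
qed

section \<open>Distances in the butterfly network\<close>

text \<open>A step from level \<open>j\<close> to level \<open>j + 1\<close> overwrites bit \<open>j\<close> by an arbitrary value \<open>b\<close>; the edge
  is straight or crossing according to whether \<open>b\<close> is the old value.\<close>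

definition level_edge :: "nat \<Rightarrow> bool list \<Rightarrow> bool \<Rightarrow> (nat \<times> bool list) set" where
  "level_edge j s b = {(j, s), (Suc j, s[j := b])}"

lemma level_edge_inj:
  "level_edge j s b = level_edge k t c \<Longrightarrow> j = k \<and> s = t \<and> s[j := b] = t[j := c]"
  by (auto simp: level_edge_def doubleton_eq_iff)

lemma bits_eq_or_flip_iff:
  assumes "length s = r" "length t = r" "j < r"
  shows "s = t \<or> {i. i < r \<and> s ! i \<noteq> t ! i} = {j} \<longleftrightarrow> (\<exists>b. t = s[j := b])"
proof
  assume L: "s = t \<or> {i. i < r \<and> s ! i \<noteq> t ! i} = {j}"
  have "s ! i = t ! i" if "i < r" "i \<noteq> j" for i
    using L that by blast
  then have "t = s[j := t ! j]"
    using assms by (intro nth_equalityI) (simp_all add: nth_list_update)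
  then show "\<exists>b. t = s[j := b]" ..
next
  assume "\<exists>b. t = s[j := b]"
  then obtain b where b: "t = s[j := b]" ..
  show "s = t \<or> {i. i < r \<and> s ! i \<noteq> t ! i} = {j}"
  proof (cases "b = s ! j")
    case True
    then show ?thesis using b by simp
  next
    case False
    then show ?thesis using b assms by (auto simp: nth_list_update)
  qed
qed

lemma verts_butterfly: "verts (butterfly r) = {(j, s). j \<le> r \<and> length s = r}"
  by (simp add: butterfly_def butterfly_verts_def)

lemma edges_butterfly:
  "edges (butterfly r) = {level_edge j s b | j s b. j < r \<and> length s = r}"
proof (intro subset_antisym subsetI)
  fix e assume "e \<in> edges (butterfly r)"
  then obtain j s t where e: "e = {(j, s), (Suc j, t)}" "j < r" "length s = r" "length t = r"
    and "s = t \<or> {i. i < r \<and> s ! i \<noteq> t ! i} = {j}"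
    unfolding butterfly_def butterfly_verts_def by auto
  then obtain b where "t = s[j := b]" using bits_eq_or_flip_iff[of s r t j] by blast
  then show "e \<in> {level_edge j s b | j s b. j < r \<and> length s = r}"
    using e unfolding level_edge_def by blast
next
  fix e assume "e \<in> {level_edge j s b | j s b. j < r \<and> length s = r}"
  then obtain j s b where e: "e = {(j, s), (Suc j, s[j := b])}" "j < r" "length s = r"
    unfolding level_edge_def by blast
  then have "s = s[j := b] \<or> {i. i < r \<and> s ! i \<noteq> s[j := b] ! i} = {j}"
    using bits_eq_or_flip_iff[of s r "s[j := b]" j] by auto
  moreover have "(j, s) \<in> butterfly_verts r" "(Suc j, s[j := b]) \<in> butterfly_verts r"
    using e by (auto simp: butterfly_verts_def)
  ultimately show "e \<in> edges (butterfly r)"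
    unfolding butterfly_def snd_conv e(1) Suc_eq_plus1 by blast
qed

lemma edges_butterfly_subset_verts: "e \<in> edges (butterfly r) \<Longrightarrow> e \<subseteq> verts (butterfly r)"
  by (auto simp: edges_butterfly verts_butterfly level_edge_def)

text \<open>A monotone walk from level \<open>j\<close> to level \<open>k\<close> passes each of the bits \<open>j, \<dots>, k - 1\<close> once and
  can set it to the desired value.\<close>

lemma monotone_walk:
  assumes "j \<le> k" "k \<le> r" "length s = r" "length t = r"
    and "\<And>i. i < r \<Longrightarrow> i < j \<or> k \<le> i \<Longrightarrow> s ! i = t ! i"
  shows "((j, s), (k, t)) \<in> adj (butterfly r) ^^ (k - j)"
  using assms
proof (induction k arbitrary: t rule: dec_induct)
  case base
  then have "s ! i = t ! i" if "i < r" for i using that linorder_not_le by blast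
  then have "s = t" using base.prems by (intro nth_equalityI) auto
  then show ?case by simp
next
  case (step k)
  let ?u = "t[k := s ! k]"
  have "((j, s), (k, ?u)) \<in> adj (butterfly r) ^^ (k - j)"
    using step.hyps step.prems by (intro step.IH) (auto simp: nth_list_update)
  moreover have "((k, ?u), (Suc k, t)) \<in> adj (butterfly r)"
  proof -
    have "{(k, ?u), (Suc k, t)} = level_edge k ?u (t ! k)"
      by (simp add: level_edge_def)
    then show ?thesis
      using step.prems unfolding adj_def edges_butterfly by force
  qed
  ultimately show ?case using step.hyps by (auto simp: Suc_diff_le)
qed

text \<open>Two vertices at levels \<open>j \<le> k\<close> are joined by going from \<open>j\<close> down to level \<open>0\<close>, from there to
  level \<open>r\<close> while setting all bits, and back to level \<open>k\<close>.\<close>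

lemma walk_between_levels:
  assumes "j \<le> k" "k \<le> r" "length s = r" "length t = r"
  shows "((j, s), (k, t)) \<in> adj (butterfly r) ^^ (j + r + (r - k))"
proof -
  have "((j, s), (0, s)) \<in> adj (butterfly r) ^^ j"
    using monotone_walk[of 0 j r s s] assms by (simp add: adj_relpow_sym)
  moreover have "((0, s), (r, t)) \<in> adj (butterfly r) ^^ r"
    using monotone_walk[of 0 r r s t] assms by simp
  moreover have "((r, t), (k, t)) \<in> adj (butterfly r) ^^ (r - k)"
    using monotone_walk[of k r r t t] assms by (simp add: adj_relpow_sym)
  ultimately show ?thesis unfolding relpow_add by blast
qed

lemma butterfly_geodesic_length_le:
  assumes "geodesic (butterfly r) p"
  shows "length p - 1 \<le> 2 * r"
proof -
  obtain j s k t where ends: "hd p = (j, s)" "last p = (k, t)" by fastforce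
  have ne: "p \<noteq> []" "set p \<subseteq> verts (butterfly r)"
    using assms by (auto simp: geodesic_def is_path_def)
  then have "hd p \<in> verts (butterfly r)" "last p \<in> verts (butterfly r)" by auto
  then have *: "j \<le> r" "k \<le> r" "length s = r" "length t = r"
    using ends by (auto simp: verts_butterfly)
  show ?thesis
  proof (cases "j \<le> k")
    case True
    then have "((j, s), (k, t)) \<in> adj (butterfly r) ^^ (j + r + (r - k))"
      using * by (intro walk_between_levels)
    then have "length p - 1 \<le> j + r + (r - k)"
      using geodesic_length_le_walk[OF edges_butterfly_subset_verts assms] ends by simp
    then show ?thesis using True * by simp
  next
    case False
    then have "((k, t), (j, s)) \<in> adj (butterfly r) ^^ (k + r + (r - j))"
      using * by (intro walk_between_levels) auto
    then have "length p - 1 \<le> k + r + (r - j)"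
      using geodesic_length_le_walk[OF edges_butterfly_subset_verts assms] ends
      by (simp add: adj_relpow_sym)
    then show ?thesis using False * by simp
  qed
qed

lemma butterfly_path_step:
  assumes "is_path (butterfly r) q" "Suc i < length q"
  shows "\<exists>j s b. {q ! i, q ! Suc i} = {(j, s), (Suc j, s[j := b])}"
proof -
  have "{q ! i, q ! Suc i} \<in> edges (butterfly r)"
    using assms by (auto simp: is_path_def path_edges_def)
  then show ?thesis by (auto simp: edges_butterfly level_edge_def)
qed

lemma butterfly_path_level_diff:
  assumes "is_path (butterfly r) q" "i + n < length q"
  shows "fst (q ! (i + n)) \<le> fst (q ! i) + n \<and> fst (q ! i) \<le> fst (q ! (i + n)) + n"
  using assms(2)
proof (induction n)
  case (Suc n)
  obtain j s b where "{q ! (i + n), q ! Suc (i + n)} = {(j, s), (Suc j, s[j := b])}"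
    using butterfly_path_step[OF assms(1), of "i + n"] Suc.prems by auto
  then show ?case using Suc by (auto simp: doubleton_eq_iff)
qed simp

text \<open>Only the edges at level \<open>r\<close> can change the last bit.\<close>

lemma butterfly_path_last_bit:
  assumes "is_path (butterfly r) q" "\<forall>i < length q. fst (q ! i) < r" "n < length q"
  shows "snd (q ! n) ! (r - 1) = snd (q ! 0) ! (r - 1)"
  using assms(3)
proof (induction n)
  case (Suc n)
  obtain j s b where *: "{q ! n, q ! Suc n} = {(j, s), (Suc j, s[j := b])}"
    using butterfly_path_step[OF assms(1), of n] Suc.prems by auto
  have "fst (q ! n) < r" "fst (q ! Suc n) < r" using assms(2) Suc.prems by auto
  then have "Suc j < r" using * by (auto simp: doubleton_eq_iff)
  then have "s[j := b] ! (r - 1) = s ! (r - 1)" by simp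
  then have "snd (q ! Suc n) ! (r - 1) = snd (q ! n) ! (r - 1)"
    using * by (auto simp: doubleton_eq_iff)
  then show ?case using Suc by simp
qed simp

text \<open>A path between level-\<open>0\<close> vertices that differ in the last bit visits level \<open>r\<close>, so it takes
  \<open>r\<close> steps to get there and \<open>r\<close> more to return.\<close>

lemma butterfly_path_length_ge:
  assumes q: "is_path (butterfly r) q" and ends: "hd q = (0, s)" "last q = (0, t)"
    and diff: "s ! (r - 1) \<noteq> t ! (r - 1)"
  shows "2 * r + 1 \<le> length q"
proof -
  have ne: "q \<noteq> []" using q by (simp add: is_path_def)
  then have nth: "q ! 0 = (0, s)" "q ! (length q - 1) = (0, t)"
    using ends by (simp_all add: hd_conv_nth last_conv_nth)
  have "\<not> (\<forall>i < length q. fst (q ! i) < r)"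
    using butterfly_path_last_bit[OF q, of "length q - 1"] ne nth diff by auto
  then obtain i where i: "i < length q" "r \<le> fst (q ! i)" by auto
  have "r \<le> i"
    using butterfly_path_level_diff[OF q, of 0 i] i nth by simp
  moreover have "r \<le> length q - 1 - i"
    using butterfly_path_level_diff[OF q, of i "length q - 1 - i"] i nth(2) by (auto simp: ne)
  ultimately show ?thesis using i by simp
qed

section \<open>A partition into longest geodesics\<close>

definition flip_from :: "nat \<Rightarrow> bool list \<Rightarrow> bool list" where
  "flip_from j s = take j s @ map Not (drop j s)"

lemma length_flip_from [simp]: "length (flip_from j s) = length s"
  by (simp add: flip_from_def)

lemma nth_flip_from:
  "i < length s \<Longrightarrow> flip_from j s ! i = (if i < j then s ! i else \<not> s ! i)"
  by (auto simp: flip_from_def nth_append)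

lemma flip_from_involution [simp]: "flip_from j (flip_from j s) = s"
  by (intro nth_equalityI) (auto simp: nth_flip_from)

lemma flip_from_all [simp]: "length s \<le> j \<Longrightarrow> flip_from j s = s"
  by (simp add: flip_from_def)

lemma flip_from_Suc:
  "j < length s \<Longrightarrow> flip_from (Suc j) s = (flip_from j s)[j := s ! j]"
  by (intro nth_equalityI) (auto simp: nth_flip_from nth_list_update)

text \<open>From \<open>(0, t)\<close> straight edges lead to \<open>(r, t)\<close>; the way back to level \<open>0\<close> crosses at every level,
  so that it meets level \<open>j\<close> in the string \<open>t\<close> with all bits from \<open>j\<close> on negated.\<close>

definition turning_vertex :: "nat \<Rightarrow> bool list \<Rightarrow> nat \<Rightarrow> nat \<times> bool list" where
  "turning_vertex r t i = (if i \<le> r then (i, t) else (2 * r - i, flip_from (2 * r - i) t))"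

definition turning_path :: "nat \<Rightarrow> bool list \<Rightarrow> (nat \<times> bool list) list" where
  "turning_path r t = map (turning_vertex r t) [0..<Suc (2 * r)]"

lemma length_turning_path: "length (turning_path r t) = Suc (2 * r)"
  by (simp add: turning_path_def)

lemma hd_turning_path: "hd (turning_path r t) = (0, t)"
  by (simp add: turning_path_def turning_vertex_def hd_map del: upt_Suc)

lemma last_turning_path:
  assumes "r > 0"
  shows "last (turning_path r t) = (0, flip_from 0 t)"
  using assms by (simp add: turning_path_def turning_vertex_def)

lemma path_edges_turning_path:
  assumes "length t = r"
  shows "path_edges (turning_path r t) =
    {level_edge j t (t ! j) | j. j < r} \<union> {level_edge j (flip_from j t) (t ! j) | j. j < r}"
    (is "_ = ?A \<union> ?B")
proof -
  let ?f = "turning_vertex r t"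
  have A: "{?f i, ?f (Suc i)} = level_edge i t (t ! i)" if "i < r" for i
    using that by (simp add: turning_vertex_def level_edge_def)
  have B: "{?f (2 * r - Suc j), ?f (Suc (2 * r - Suc j))} = level_edge j (flip_from j t) (t ! j)"
    if "j < r" for j
  proof -
    have "?f (2 * r - Suc j) = (Suc j, flip_from (Suc j) t)"
    proof (cases "Suc j = r")
      case True
      then show ?thesis using assms by (auto simp: turning_vertex_def)
    next
      case False
      then show ?thesis using that by (auto simp: turning_vertex_def)
    qed
    moreover have "?f (Suc (2 * r - Suc j)) = (j, flip_from j t)"
      using that by (auto simp: turning_vertex_def)
    ultimately show ?thesis
      using that assms by (simp add: level_edge_def flip_from_Suc insert_commute)
  qed
  have "path_edges (turning_path r t) = (\<lambda>i. {?f i, ?f (Suc i)}) ` {..<2 * r}"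
    unfolding turning_path_def path_edges_map_upt by auto
  also have "{..<2 * r} = {..<r} \<union> (\<lambda>j. 2 * r - Suc j) ` {..<r}"
  proof -
    have "i \<in> (\<lambda>j. 2 * r - Suc j) ` {..<r}" if "i < 2 * r" "\<not> i < r" for i
      using that by (intro image_eqI[of _ _ "2 * r - Suc i"]) auto
    then show ?thesis by auto
  qed
  also have "(\<lambda>i. {?f i, ?f (Suc i)}) ` \<dots> =
      (\<lambda>i. {?f i, ?f (Suc i)}) ` {..<r} \<union>
      (\<lambda>j. {?f (2 * r - Suc j), ?f (Suc (2 * r - Suc j))}) ` {..<r}"
    by (simp only: image_Un image_image)
  also have "\<dots> = (\<lambda>j. level_edge j t (t ! j)) ` {..<r} \<union>
      (\<lambda>j. level_edge j (flip_from j t) (t ! j)) ` {..<r}"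
    using A B by (intro arg_cong2[where f = "(\<union>)"] image_cong refl) auto
  also have "\<dots> = ?A \<union> ?B" by auto
  finally show ?thesis .
qed

lemma distinct_turning_path:
  assumes "length t = r" "r > 0"
  shows "distinct (turning_path r t)"
proof -
  \<comment> \<open>At a level \<open>k < r\<close> the two halves of the path differ, for instance in bit \<open>k\<close>.\<close>
  have ne: "flip_from k t \<noteq> t" if "k < r" for k
  proof
    assume "flip_from k t = t"
    moreover have "flip_from k t ! k = (\<not> t ! k)" using that assms by (simp add: nth_flip_from)
    ultimately show False by simp
  qed
  have "inj_on (turning_vertex r t) {0..<Suc (2 * r)}"
  proof (rule inj_onI)
    fix i k
    assume "i \<in> {0..<Suc (2 * r)}" "k \<in> {0..<Suc (2 * r)}"
      "turning_vertex r t i = turning_vertex r t k"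
    then show "i = k"
      using ne[of "2 * r - i"] ne[of "2 * r - k"] ne[symmetric, of "2 * r - i"]
        ne[symmetric, of "2 * r - k"]
      by (cases "i \<le> r"; cases "k \<le> r") (auto simp: turning_vertex_def)
  qed
  then show ?thesis by (simp add: turning_path_def distinct_map del: upt_Suc)
qed

text \<open>The end vertices \<open>(0, t)\<close> and \<open>(0, flip_from 0 t)\<close> differ in every bit, in particular in the
  last one, so no path between them has fewer than \<open>2 * r\<close> edges.\<close>

lemma geodesic_turning_path:
  assumes "length t = r" "r > 0"
  shows "geodesic (butterfly r) (turning_path r t)"
proof -
  have "set (turning_path r t) \<subseteq> verts (butterfly r)"
    using assms by (auto simp: turning_path_def turning_vertex_def verts_butterfly)
  moreover have "path_edges (turning_path r t) \<subseteq> edges (butterfly r)"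
    unfolding path_edges_turning_path[OF assms(1)] edges_butterfly using assms(1) by force
  moreover have "turning_path r t \<noteq> []" using length_turning_path[of r t] by auto
  ultimately have "is_path (butterfly r) (turning_path r t)"
    using distinct_turning_path[OF assms] by (simp add: is_path_def)
  moreover have "t ! (r - 1) \<noteq> flip_from 0 t ! (r - 1)"
    using assms by (simp add: nth_flip_from)
  ultimately show ?thesis
    using butterfly_path_length_ge assms(2)
    by (simp add: geodesic_def length_turning_path hd_turning_path last_turning_path)
qed

text \<open>A straight edge starting in \<open>(j, s)\<close> lies on the path of \<open>s\<close> only, and a crossing edge starting
  in \<open>(j, s)\<close> on the path of \<open>flip_from j s\<close> only.\<close>

lemma turning_paths_disjoint:
  assumes len: "length t = r" "length u = r"
    and e: "e \<in> path_edges (turning_path r t)" "e \<in> path_edges (turning_path r u)"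
  shows "t = u"
proof -
  have straight_cross: False
    if "level_edge j v (v ! j) = level_edge k (flip_from k w) (w ! k)"
      "length v = r" "length w = r" "j < r" for j k v w
  proof -
    from level_edge_inj[OF that(1)]
    have "k = j" "v = flip_from j w" "v[j := v ! j] = (flip_from j w)[j := w ! j]" by auto
    then have "v ! j = (\<not> w ! j)" "v[j := v ! j] ! j = v[j := w ! j] ! j"
      using that by (simp_all add: nth_flip_from)
    then show False using that by simp
  qed
  from e(1) consider (straight) j where "j < r" "e = level_edge j t (t ! j)"
    | (cross) j where "j < r" "e = level_edge j (flip_from j t) (t ! j)"
    unfolding path_edges_turning_path[OF len(1)] by blast
  then show ?thesis
  proof cases
    case straight
    from e(2) consider k where "k < r" "e = level_edge k u (u ! k)"
      | k where "k < r" "e = level_edge k (flip_from k u) (u ! k)"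
      unfolding path_edges_turning_path[OF len(2)] by blast
    then show ?thesis
      using straight level_edge_inj straight_cross len by cases metis+
  next
    case cross
    from e(2) consider k where "k < r" "e = level_edge k u (u ! k)"
      | k where "k < r" "e = level_edge k (flip_from k u) (u ! k)"
      unfolding path_edges_turning_path[OF len(2)] by blast
    then show ?thesis
    proof cases
      case 1
      then show ?thesis using cross straight_cross len by metis
    next
      case 2
      then have "flip_from j t = flip_from j u" using cross level_edge_inj by metis
      then show ?thesis by (metis flip_from_involution)
    qed
  qed
qed

lemma turning_paths_cover:
  assumes "e \<in> edges (butterfly r)"
  shows "\<exists>t. length t = r \<and> e \<in> path_edges (turning_path r t)"
proof -
  obtain j s b where e: "e = level_edge j s b" "j < r" "length s = r"
    using assms by (auto simp: edges_butterfly)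
  show ?thesis
  proof (cases "b = s ! j")
    case True
    then have "e \<in> path_edges (turning_path r s)"
      unfolding path_edges_turning_path[OF e(3)] using e by blast
    then show ?thesis using e by blast
  next
    case False
    let ?t = "flip_from j s"
    have "?t ! j = b" using False e by (auto simp: nth_flip_from)
    then have "e = level_edge j (flip_from j ?t) (?t ! j)" using e by simp
    moreover have len: "length ?t = r" using e by simp
    ultimately have "e \<in> path_edges (turning_path r ?t)"
      unfolding path_edges_turning_path[OF len] using e(2) by blast
    then show ?thesis using len by blast
  qed
qed

lemma turning_paths_partition:
  assumes "r > 0"
  shows "edge_geodesic_partition (butterfly r) (turning_path r ` {t. length t = r})"
proof -
  have "finite {t :: bool list. length t = r}"
    using finite_lists_length_eq[of "UNIV :: bool set" r] by simp
  then have "edge_geodesic_cover (butterfly r) (turning_path r ` {t. length t = r})"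
    using assms geodesic_turning_path turning_paths_cover
    by (auto simp: edge_geodesic_cover_def)
  moreover have "path_edges (turning_path r t) \<inter> path_edges (turning_path r u) = {}"
    if "length t = r" "length u = r" "turning_path r t \<noteq> turning_path r u" for t u
    using that turning_paths_disjoint[OF that(1,2)] by auto
  ultimately show ?thesis by (auto simp: edge_geodesic_partition_def)
qed

lemma card_turning_paths: "card (turning_path r ` {t. length t = r}) = 2 ^ r"
proof -
  have "inj_on (turning_path r) {t. length t = r}"
    by (rule inj_onI) (metis hd_turning_path prod.inject)
  then have "card (turning_path r ` {t. length t = r}) = card {t :: bool list. length t = r}"
    by (rule card_image)
  also have "\<dots> = 2 ^ r"
    using card_lists_length_eq[of "UNIV :: bool set" r] by simp
  finally show ?thesis .
qed

theorem theorem4p2: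
  fixes r :: nat
  assumes "r \<ge> 3"
  shows "gcover_e (butterfly r) = 2 ^ r \<and> gpart_e (butterfly r) = 2 ^ r"
proof -
  have "r > 0" using assms by simp
  then have "gcover_e (butterfly r) = card (turning_path r ` {t. length t = r}) \<and>
      gpart_e (butterfly r) = card (turning_path r ` {t. length t = r})"
    using butterfly_geodesic_length_le length_turning_path
    by (intro cover_partition_number_eqI[where d = "2 * r"] turning_paths_partition) auto
  then show ?thesis by (simp add: card_turning_paths)
qed

end
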